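(* Let $\mathcal B$ be a basis of a real Banach space $\mathbb X$ and let $w=(w_n)_{n=1}^\infty$ be a weight equivalent to a constant, that is, $0<\inf_nw_n\le\sup_nw_n<\infty$. If $\mathcal B$ is $w$-semi-greedy, then $\mathcal B$ satisfies the Property (C).
   Context: Basis: a Schauder basis $\mathcal B=(e_n)_{n=1}^\infty$ of a real Banach space $\mathbb X$ with biorthogonal functionals $(e_n^* )_{n=1}^\infty$ such that $0<\inf_n\min\{\|e_n\|,\|e_n^*\|\}\le\sup_n\max\{\|e_n\|,\|e_n^*\|\}<\infty$. For $x\in\mathbb X$, $\mathrm{supp}(x)=\{i\in\mathbb N: e_i^*(x)\neq0\}$. $\mathbb N^{<\infty}$ is the family of finite subsets of $\mathbb N$. For signs $\varepsilon=(\varepsilon_n)$, $\varepsilon_n\in\{\pm1\}$, and finite $A$, $\mathbf 1_{\varepsilon A}=\sum_{n\in A}\varepsilon_ne_n$. A weight is a sequence $w=(w_i)_{i=1}^\infty\in(0,\infty)^{\mathbb N}$; $w(A)=\sum_{i\in A}w_i$. A greedy set of $x$ of cardinality $m\in\mathbb N$ is a set $A_m(x)\subset\mathrm{supp}(x)$ with $|A_m(x)|=m$ and $\min_{k\in A_m(x)}|e_k^*(x)|\ge\sup_{k\notin A_m(x)}|e_k^*(x)|$. A Chebyshev greedy approximand of order $m$ is any $\overline G_m(x)\in\mathrm{span}\{e_i: i\in A_m(x)\}$ with $\|x-\overline G_m(x)\|=\min\{\|x-\sum_{n\in A_m(x)}b_ne_n\|: b_n\in\mathbb R\}$. Inequalities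 involving these objects are required for every choice of greedy set. $\mathcal B$ is $w$-semi-greedy if there is $C\ge1$ such that $\|x-\overline G_m(x)\|\le C\,\sigma^w_{w(A_m(x))}(x)$ for all $x\in\mathbb X$, $m\in\mathbb N$, where $\sigma^w_\delta(x)=\inf\{\|x-\sum_{n\in A}a_ne_n\|: A\in\mathbb N^{<\infty},\ w(A)\le\delta,\ a_n\in\mathbb R\}$. $\mathcal B$ satisfies the Property (C) if there is a constant $C>0$ with $\min_{j\in\Lambda}|e_j^*(x)|\,\|\mathbf 1_{\varepsilon\Lambda}\|\le C\|x\|$ for all $x\in\mathbb X$, every greedy set $\Lambda$ of $x$ (of any cardinality) and all signs $\varepsilon$. *)

theory Defs
  imports "HOL-Analysis.Analysis"
begin

text \<open>Bases, weights and sign sequences are indexed from 0 instead of 1.\<close>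

definition schauder_basis :: "(nat \<Rightarrow> 'a::banach) \<Rightarrow> bool" where
  "schauder_basis e \<longleftrightarrow> (\<forall>x. \<exists>!a. (\<lambda>n. a n *\<^sub>R e n) sums x)"

definition biorthogonal :: "(nat \<Rightarrow> 'a::banach) \<Rightarrow> (nat \<Rightarrow> 'a \<Rightarrow>\<^sub>L real) \<Rightarrow> bool" where
  "biorthogonal e es \<longleftrightarrow> (\<forall>i j. blinfun_apply (es i) (e j) = (if i = j then 1 else 0))"

text \<open>The functionals live in the dual space \<^typ>\<open>'a \<Rightarrow>\<^sub>L real\<close>, whose norm is the operator norm;
  for a Schauder basis \<open>e\<close> they are uniquely determined by biorthogonality and continuity.
  Finiteness of a real supremum is expressed by boundedness from above, since \<^const>\<open>Sup\<close> is
  unspecified on unbounded sets of reals.\<close>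

definition basis_system :: "(nat \<Rightarrow> 'a::banach) \<Rightarrow> (nat \<Rightarrow> 'a \<Rightarrow>\<^sub>L real) \<Rightarrow> bool" where
  "basis_system e es \<longleftrightarrow>
     schauder_basis e \<and> biorthogonal e es \<and>
     0 < (INF n. min (norm (e n)) (norm (es n))) \<and>
     bdd_above (range (\<lambda>n. max (norm (e n)) (norm (es n))))"

definition supp :: "(nat \<Rightarrow> 'a::banach \<Rightarrow>\<^sub>L real) \<Rightarrow> 'a \<Rightarrow> nat set" where
  "supp es x = {i. blinfun_apply (es i) x \<noteq> 0}"

definition sign_sequence :: "(nat \<Rightarrow> real) \<Rightarrow> bool" where
  "sign_sequence \<epsilon> \<longleftrightarrow> (\<forall>n. \<epsilon> n \<in> {1, -1})"

definition signed_indicator :: "(nat \<Rightarrow> 'a::banach) \<Rightarrow> (nat \<Rightarrow> real) \<Rightarrow> nat set \<Rightarrow> 'a" where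
  "signed_indicator e \<epsilon> A = (\<Sum>n\<in>A. \<epsilon> n *\<^sub>R e n)"

definition weight :: "(nat \<Rightarrow> real) \<Rightarrow> bool" where
  "weight w \<longleftrightarrow> (\<forall>i. 0 < w i)"

text \<open>Cardinalities are positive, so the minimum below is over a nonempty finite set; the
  supremum is over a nonempty set, and for a basis it is finite because the functionals are
  uniformly bounded.\<close>

definition greedy_set :: "(nat \<Rightarrow> 'a::banach \<Rightarrow>\<^sub>L real) \<Rightarrow> 'a \<Rightarrow> nat \<Rightarrow> nat set \<Rightarrow> bool" where
  "greedy_set es x m A \<longleftrightarrow>
     m \<ge> 1 \<and> finite A \<and> card A = m \<and> A \<subseteq> supp es x \<and>
     Min ((\<lambda>k. \<bar>blinfun_apply (es k) x\<bar>) ` A) \<ge> (SUP k\<in>-A. \<bar>blinfun_apply (es k) x\<bar>)"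

definition chebyshev_approximand :: "(nat \<Rightarrow> 'a::banach) \<Rightarrow> 'a \<Rightarrow> nat set \<Rightarrow> 'a \<Rightarrow> bool" where
  "chebyshev_approximand e x A G \<longleftrightarrow>
     G \<in> span (e ` A) \<and> (\<forall>b. norm (x - G) \<le> norm (x - (\<Sum>n\<in>A. b n *\<^sub>R e n)))"

definition sigma_w :: "(nat \<Rightarrow> 'a::banach) \<Rightarrow> (nat \<Rightarrow> real) \<Rightarrow> real \<Rightarrow> 'a \<Rightarrow> real" where
  "sigma_w e w \<delta> x =
     Inf {norm (x - (\<Sum>n\<in>A. a n *\<^sub>R e n)) | A a. finite A \<and> sum w A \<le> \<delta>}"

definition w_semi_greedy ::
    "(nat \<Rightarrow> 'a::banach) \<Rightarrow> (nat \<Rightarrow> 'a \<Rightarrow>\<^sub>L real) \<Rightarrow> (nat \<Rightarrow> real) \<Rightarrow> bool" where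
  "w_semi_greedy e es w \<longleftrightarrow>
     (\<exists>C\<ge>1. \<forall>x m A G. greedy_set es x m A \<longrightarrow> chebyshev_approximand e x A G \<longrightarrow>
        norm (x - G) \<le> C * sigma_w e w (sum w A) x)"

definition property_C :: "(nat \<Rightarrow> 'a::banach) \<Rightarrow> (nat \<Rightarrow> 'a \<Rightarrow>\<^sub>L real) \<Rightarrow> bool" where
  "property_C e es \<longleftrightarrow>
     (\<exists>C>0. \<forall>x m \<Lambda> \<epsilon>. greedy_set es x m \<Lambda> \<longrightarrow> sign_sequence \<epsilon> \<longrightarrow>
        Min ((\<lambda>j. \<bar>blinfun_apply (es j) x\<bar>) ` \<Lambda>) * norm (signed_indicator e \<epsilon> \<Lambda>) \<le> C * norm x)"

end

theory Submission
  imports Defs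
begin

text \<open>
  Let \<open>\<Lambda>\<close> be a greedy set of \<open>x\<close>, let \<open>t\<close> be the least modulus of a coordinate of \<open>x\<close> on \<open>\<Lambda>\<close>,
  let \<open>K\<close> bound the initial partial sum projections of the basis and let \<open>C\<close> be the semi-greedy
  constant.  The vectors \<open>t 1\<^bsub>\<epsilon>\<Lambda>\<^esub>\<close> and \<open>x\<close> are both compared with \<open>t 1\<^bsub>B\<^esub>\<close>, where \<open>B\<close> is
  a block of consecutive indices to the right of \<open>\<Lambda>\<close>.  Each comparison applies the semi-greedy
  inequality to an auxiliary vector and then removes the unknown Chebyshev approximand by a
  projection that annihilates it.

  \<^item> If \<open>w(\<Lambda>) \<le> w(B)\<close>, then \<open>B\<close> is a greedy set of \<open>1\<^bsub>\<epsilon>\<Lambda>\<^esub> + 1\<^bsub>B\<^esub>\<close>, and \<open>1\<^bsub>\<epsilon>\<Lambda>\<^esub>\<close> is an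
    admissible competitor.  The initial projection kills the span of \<open>B\<close>, so
    \<open>\<parallel>1\<^bsub>\<epsilon>\<Lambda>\<^esub>\<parallel> \<le> K C \<parallel>1\<^bsub>B\<^esub>\<parallel>\<close> (\<open>signed_indicator_le_block\<close>).

  \<^item> If \<open>w(B) \<le> w(\<Lambda>)\<close>, replace the coordinates of \<open>x\<close> on \<open>B\<close> by \<open>t\<close>.  The set \<open>\<Lambda>\<close> is still
    greedy for the new vector, and undoing the replacement is an admissible competitor with
    error \<open>\<parallel>x\<parallel>\<close>.  The projection onto \<open>B\<close> kills the span of \<open>\<Lambda>\<close>, so
    \<open>t \<parallel>1\<^bsub>B\<^esub>\<parallel> \<le> 2 K C \<parallel>x\<parallel>\<close> (\<open>block_le_vector\<close>).

  One block cannot in general satisfy both weight conditions.  However, a maximal block with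
  \<open>w(B) \<le> w(\<Lambda>)\<close> satisfies the other condition after one more index is adjoined
  (\<open>maximal_block\<close>), and a single basis vector changes \<open>t \<parallel>1\<^bsub>B\<^esub>\<parallel>\<close> by at most a constant times
  \<open>\<parallel>x\<parallel>\<close>, because \<open>t\<close> is at most the modulus of a coordinate of \<open>x\<close>.

  Two facts from functional analysis support this: the finiteness of \<open>K\<close>, which is the
  Banach--Steinhaus theorem applied to the partial sums, and the existence of Chebyshev
  approximands, which is compactness in the finite-dimensional span of \<open>\<Lambda>\<close>.
\<close>

section \<open>Uniform boundedness\<close>

text \<open>
  The Banach--Steinhaus theorem for sequences.  By Baire's theorem, one of the closed sets on which
  all \<open>T n\<close> are bounded by a given integer \<open>k\<close> contains a ball; by linearity, the bound on a ball
  around \<open>x0\<close> gives a bound on a ball around the origin.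
\<close>

lemma pointwise_bounded_imp_uniformly_bounded:
  fixes T :: "nat \<Rightarrow> 'a::banach \<Rightarrow> 'b::real_normed_vector"
  assumes lin: "\<And>n. bounded_linear (T n)"
    and pointwise: "\<And>x. \<exists>c. \<forall>n. norm (T n x) \<le> c"
  shows "\<exists>K>0. \<forall>n x. norm (T n x) \<le> K * norm x"
proof -
  define F where "F k = {x. \<forall>n. norm (T n x) \<le> real k}" for k
  have closed_F: "closed (F k)" for k
    unfolding F_def
    by (intro closed_Collect_all closed_Collect_le continuous_intros
        linear_continuous_on lin)
  have cover: "(\<Union>k. F k) = UNIV"
  proof (intro equalityI subsetI)
    fix x :: 'a
    obtain c where c: "\<forall>n. norm (T n x) \<le> c" using pointwise by blast
    obtain k where "c \<le> real k" using real_arch_simple by blast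
    then have "x \<in> F k" using c unfolding F_def by (auto intro: order_trans)
    then show "x \<in> (\<Union>k. F k)" by blast
  qed simp
  have "\<exists>k. interior (F k) \<noteq> {}"
  proof (rule ccontr)
    assume "\<not> ?thesis"
    then have "euclidean interior_of (\<Union>(range F)) = {}"
      using closed_F
      by (intro Baire_category_alt)
        (auto simp: completely_metrizable_space_euclidean)
    then show False using cover by simp
  qed
  then obtain k x0 where "x0 \<in> interior (F k)" by blast
  then obtain r where r: "r > 0" "ball x0 r \<subseteq> F k"
    by (meson mem_interior)
  have bound: "norm (T n x) \<le> (4 * real k / r) * norm x" for n x
  proof (cases "x = 0")
    case True
    then show ?thesis by (simp add: linear_simps(3)[OF lin])
  next
    case False
    \<comment> \<open>The factor moves \<open>x\<close> to norm \<open>r / 2\<close>, so that \<open>x0 + s *\<^sub>R x\<close> stays in the open ball.\<close>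
    define s where "s = r / (2 * norm x)"
    have s: "s > 0" using r False by (simp add: s_def)
    have "norm (s *\<^sub>R x) = r / 2" using r False by (simp add: s_def)
    then have "x0 + s *\<^sub>R x \<in> F k" "x0 \<in> F k"
      using r by (auto simp: dist_norm intro!: subsetD[OF r(2)])
    then have b: "norm (T n (x0 + s *\<^sub>R x)) \<le> k" "norm (T n x0) \<le> k"
      unfolding F_def by auto
    have "s *\<^sub>R T n x = T n (x0 + s *\<^sub>R x) - T n x0"
      by (simp add: linear_simps[OF lin])
    then have "s * norm (T n x) = norm (T n (x0 + s *\<^sub>R x) - T n x0)"
      using s by (metis abs_of_pos norm_scaleR)
    also have "\<dots> \<le> 2 * real k"
      using norm_triangle_ineq4[of "T n (x0 + s *\<^sub>R x)" "T n x0"] b by linarith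
    finally have "norm (T n x) \<le> 2 * real k / s"
      using s by (simp add: field_simps)
    also have "\<dots> = (4 * real k / r) * norm x"
      using r False by (simp add: s_def field_simps)
    finally show ?thesis .
  qed
  \<comment> \<open>The summand 1 makes the constant positive when \<open>k = 0\<close>.\<close>
  show ?thesis
  proof (intro exI[of _ "4 * real k / r + 1"] conjI allI)
    show "norm (T n x) \<le> (4 * real k / r + 1) * norm x" for n x
      using bound[of n x] by (simp add: distrib_right add_increasing2)
    show "0 < 4 * real k / r + 1"
      using r by (intro add_nonneg_pos) auto
  qed
qed

section \<open>Bases with bounded biorthogonal functionals\<close>

locale seminormalized_basis =
  fixes e :: "nat \<Rightarrow> 'a::banach" and es :: "nat \<Rightarrow> 'a \<Rightarrow>\<^sub>L real"
  assumes basis: "basis_system e es"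
begin

lemma coordinate_scaled: "es i (c *\<^sub>R e j) = (if i = j then c else 0)"
  using basis by (simp add: basis_system_def biorthogonal_def blinfun.scaleR_right)

lemma coordinate_sum:
  "finite A \<Longrightarrow> es i (\<Sum>n\<in>A. b n *\<^sub>R e n) = (if i \<in> A then b i else 0)"
  by (simp add: blinfun.sum_right coordinate_scaled)

lemma common_bound:
  obtains R where "R > 0" "\<And>n. norm (e n) \<le> R" "\<And>n. norm (es n) \<le> R"
proof -
  obtain R where R: "\<And>n. max (norm (e n)) (norm (es n)) \<le> R"
    using basis unfolding basis_system_def bdd_above_def by auto
  show thesis
  proof (rule that)
    show "\<bar>R\<bar> + 1 > 0" by simp
    show "norm (e n) \<le> \<bar>R\<bar> + 1" "norm (es n) \<le> \<bar>R\<bar> + 1" for n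
      using R[of n] by auto
  qed
qed

text \<open>
  The unique coefficients in the definition of a Schauder basis are the values of the biorthogonal
  functionals: apply the continuous functional \<open>es k\<close> to the series term by term.
\<close>

lemma expansion: "(\<lambda>n. es n x *\<^sub>R e n) sums x"
proof -
  obtain a where a: "(\<lambda>n. a n *\<^sub>R e n) sums x"
    using basis unfolding basis_system_def schauder_basis_def by blast
  have "es k x = a k" for k
  proof -
    have "(\<lambda>n. es k (a n *\<^sub>R e n)) sums es k x"
      using a by (rule bounded_linear.sums[OF blinfun.bounded_linear_right])
    then have "(\<lambda>n. if n = k then a n else 0) sums es k x"
      by (simp add: coordinate_scaled eq_commute)
    then show ?thesis
      using sums_single[of k a] sums_unique2 by blast
  qed
  then show ?thesis using a by simp
qed

definition basis_projection :: "nat set \<Rightarrow> 'a \<Rightarrow> 'a" where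
  "basis_projection A x = (\<Sum>n\<in>A. es n x *\<^sub>R e n)"

text \<open>
  The basis constant is finite: the partial sums of the expansion of \<open>x\<close> converge, hence are bounded
  for each \<open>x\<close>, hence uniformly bounded.
\<close>

lemma initial_projection_bound:
  obtains K where "K > 0" "\<And>N x. norm (basis_projection {..<N} x) \<le> K * norm x"
proof -
  have lin: "bounded_linear (basis_projection {..<N})" for N
    unfolding basis_projection_def
    by (intro bounded_linear_sum bounded_linear_scaleR_const blinfun.bounded_linear_right)
  have "\<exists>c. \<forall>N. norm (basis_projection {..<N} x) \<le> c" for x
  proof -
    have "(\<lambda>N. basis_projection {..<N} x) \<longlonglongrightarrow> x"
      using expansion[of x] unfolding sums_def basis_projection_def .
    then have "Bseq (\<lambda>N. basis_projection {..<N} x)"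
      by (rule convergent_imp_Bseq[OF convergentI])
    then show ?thesis
      unfolding Bseq_def by blast
  qed
  from pointwise_bounded_imp_uniformly_bounded[OF lin this] that show thesis
    by blast
qed

lemma block_projection:
  assumes "N \<le> M"
  shows "basis_projection {N..<M} x = basis_projection {..<M} x - basis_projection {..<N} x"
proof -
  have "{..<M} = {..<N} \<union> {N..<M}" using assms by auto
  then show ?thesis
    unfolding basis_projection_def by (simp add: sum.union_disjoint ivl_disj_int)
qed

lemma bounded_coordinates:
  assumes "\<And>n. norm (es n) \<le> R"
  shows "\<bar>es n x\<bar> \<le> R * norm x"
  using norm_blinfun[of "es n" x] mult_right_mono[OF assms[of n] norm_ge_zero[of x]] by simp

section \<open>Greedy sets and Chebyshev approximands\<close>

text \<open>
  For finite nonempty sets, being greedy means that a positive threshold separates the moduli of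
  the coordinates inside from those outside.  The next two lemmas translate between this form
  and the one with minimum and supremum; the coordinates are bounded, so the
  supremum is an upper bound, as \<open>greedy_setD\<close> requires.
\<close>

lemma greedy_setI:
  assumes "finite A" "A \<noteq> {}" "t > 0"
    and "\<And>k. k \<in> A \<Longrightarrow> t \<le> \<bar>es k x\<bar>"
    and "\<And>k. k \<notin> A \<Longrightarrow> \<bar>es k x\<bar> \<le> t"
  shows "greedy_set es x (card A) A"
proof -
  have "(SUP k\<in>-A. \<bar>es k x\<bar>) \<le> t"
    using assms(5) ex_new_if_finite[OF infinite_UNIV_nat assms(1)] by (intro cSUP_least) auto
  also have "t \<le> Min ((\<lambda>k. \<bar>es k x\<bar>) ` A)"
    using assms by auto
  finally show ?thesis
    using assms unfolding greedy_set_def supp_def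
    by (force simp: Suc_le_eq card_gt_0_iff)
qed

lemma greedy_setD:
  assumes "greedy_set es x m A"
  defines "t \<equiv> Min ((\<lambda>k. \<bar>es k x\<bar>) ` A)"
  shows "finite A" "A \<noteq> {}" "t > 0"
    and "\<And>k. k \<in> A \<Longrightarrow> t \<le> \<bar>es k x\<bar>"
    and "\<And>k. k \<notin> A \<Longrightarrow> \<bar>es k x\<bar> \<le> t"
proof -
  show fin: "finite A" and ne: "A \<noteq> {}"
    using assms unfolding greedy_set_def by auto
  show "t > 0"
    using assms fin ne unfolding greedy_set_def supp_def t_def by auto
  show "t \<le> \<bar>es k x\<bar>" if "k \<in> A" for k
    using fin that unfolding t_def by auto
  obtain R where R: "\<And>n. norm (es n) \<le> R" using common_bound by metis
  have "bdd_above ((\<lambda>k. \<bar>es k x\<bar>) ` (-A))"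
    using bounded_coordinates[OF R] by (auto simp: bdd_above_def)
  then show "\<bar>es k x\<bar> \<le> t" if "k \<notin> A" for k
    using that assms cSUP_upper[of k "-A" "\<lambda>k. \<bar>es k x\<bar>"]
    unfolding greedy_set_def t_def by force
qed

lemma compact_bounded_combinations:
  assumes "finite A"
  shows "compact {(\<Sum>n\<in>A. b n *\<^sub>R e n) | b. \<forall>n\<in>A. \<bar>b n\<bar> \<le> (r::real)}"
  using assms
proof (induction A)
  case empty
  then show ?case by simp
next
  case (insert k A)
  let ?S = "\<lambda>A. {(\<Sum>n\<in>A. b n *\<^sub>R e n) | b. \<forall>n\<in>A. \<bar>b n\<bar> \<le> r}"
  let ?I = "(\<lambda>c. c *\<^sub>R e k) ` {-r..r}"
  have "?S (insert k A) = {x + y | x y. x \<in> ?I \<and> y \<in> ?S A}"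
  proof (intro equalityI subsetI)
    fix z assume "z \<in> ?S (insert k A)"
    then obtain b where b: "z = (\<Sum>n\<in>insert k A. b n *\<^sub>R e n)" "\<forall>n\<in>insert k A. \<bar>b n\<bar> \<le> r"
      by blast
    have "b k *\<^sub>R e k \<in> ?I" using b by (intro imageI) auto
    moreover have "(\<Sum>n\<in>A. b n *\<^sub>R e n) \<in> ?S A" using b by auto
    ultimately show "z \<in> {x + y | x y. x \<in> ?I \<and> y \<in> ?S A}"
      using b insert by auto
  next
    fix z assume "z \<in> {x + y | x y. x \<in> ?I \<and> y \<in> ?S A}"
    then obtain c b where cb: "z = c *\<^sub>R e k + (\<Sum>n\<in>A. b n *\<^sub>R e n)"
        "\<bar>c\<bar> \<le> r" "\<forall>n\<in>A. \<bar>b n\<bar> \<le> r"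
      by auto
    have "(\<Sum>n\<in>insert k A. (b(k := c)) n *\<^sub>R e n) = c *\<^sub>R e k + (\<Sum>n\<in>A. b n *\<^sub>R e n)"
      using insert by (simp, intro sum.cong) auto
    then show "z \<in> ?S (insert k A)"
      using cb by (intro CollectI exI[of _ "b(k := c)"]) auto
  qed
  moreover have "compact ?I"
    by (intro compact_continuous_image continuous_intros compact_Icc)
  then have "compact {x + y | x y. x \<in> ?I \<and> y \<in> ?S A}"
    using insert.IH by (rule compact_sums)
  ultimately show ?case by (simp only:)
qed

text \<open>
  A combination of norm greater than \<open>2 * norm x\<close> is no better an approximation of \<open>x\<close> than 0.  All
  other combinations have coefficients bounded by a multiple of \<open>norm x\<close>, because the
  biorthogonal functionals are bounded, so the minimum over a compact set is a global one.
\<close>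

lemma chebyshev_approximand_exists:
  assumes "finite A"
  obtains b where "chebyshev_approximand e x A (\<Sum>n\<in>A. b n *\<^sub>R e n)"
proof -
  obtain R where R: "R > 0" "\<And>n. norm (es n) \<le> R" using common_bound by metis
  define S where "S = {(\<Sum>n\<in>A. b n *\<^sub>R e n) | b. \<forall>n\<in>A. \<bar>b n\<bar> \<le> R * (2 * norm x)}"
  have zero: "0 \<in> S"
    unfolding S_def using R by (intro CollectI exI[of _ "\<lambda>_. 0"]) auto
  have "\<exists>G\<in>S. \<forall>y\<in>S. norm (x - G) \<le> norm (x - y)"
    using compact_bounded_combinations[OF assms] zero unfolding S_def
    by (intro continuous_attains_inf continuous_intros) auto
  then obtain G where G: "G \<in> S" "\<And>y. y \<in> S \<Longrightarrow> norm (x - G) \<le> norm (x - y)" by blast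
  obtain b where b: "G = (\<Sum>n\<in>A. b n *\<^sub>R e n)" using G unfolding S_def by blast
  have "norm (x - G) \<le> norm (x - (\<Sum>n\<in>A. c n *\<^sub>R e n))" for c
  proof (cases "norm (\<Sum>n\<in>A. c n *\<^sub>R e n) \<le> 2 * norm x")
    case True
    have "\<bar>c n\<bar> \<le> R * (2 * norm x)" if "n \<in> A" for n
    proof -
      have "\<bar>c n\<bar> \<le> R * norm (\<Sum>n\<in>A. c n *\<^sub>R e n)"
        using bounded_coordinates[OF R(2), of n "\<Sum>n\<in>A. c n *\<^sub>R e n"] that
        by (simp add: coordinate_sum[OF assms])
      also have "\<dots> \<le> R * (2 * norm x)"
        using True R(1) by (intro mult_left_mono) auto
      finally show ?thesis .
    qed
    then show ?thesis using G(2) unfolding S_def by blast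
  next
    case False
    have "norm (x - G) \<le> norm x" using G(2)[OF zero] by simp
    also have "\<dots> \<le> norm (x - (\<Sum>n\<in>A. c n *\<^sub>R e n))"
      using False norm_triangle_ineq2[of "\<Sum>n\<in>A. c n *\<^sub>R e n" x] by (simp add: norm_minus_commute)
    finally show ?thesis .
  qed
  moreover have "G \<in> span (e ` A)"
    unfolding b by (intro span_sum span_scale span_base) auto
  ultimately show thesis
    using that b unfolding chebyshev_approximand_def by blast
qed

lemma sigma_w_le:
  assumes "finite A" "sum w A \<le> \<delta>"
  shows "sigma_w e w \<delta> x \<le> norm (x - (\<Sum>n\<in>A. a n *\<^sub>R e n))"
  unfolding sigma_w_def
proof (rule cInf_lower)
  show "bdd_below {norm (x - (\<Sum>n\<in>A. a n *\<^sub>R e n)) | A a. finite A \<and> sum w A \<le> \<delta>}"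
    by (rule bdd_belowI[of _ 0]) auto
qed (intro CollectI exI[of _ A] exI[of _ a] conjI refl assms)

definition semi_greedy_constant :: "(nat \<Rightarrow> real) \<Rightarrow> real \<Rightarrow> bool" where
  "semi_greedy_constant w C \<longleftrightarrow> 1 \<le> C \<and>
     (\<forall>x m A G. greedy_set es x m A \<longrightarrow> chebyshev_approximand e x A G \<longrightarrow>
        norm (x - G) \<le> C * sigma_w e w (sum w A) x)"

text \<open>
  The form in which the semi-greedy condition is used: some element of the span of a greedy set is,
  up to the factor \<open>C\<close>, as good as any given competitor of at most the same weight.  Which element
  this is does not matter, since the arguments below project it away.
\<close>

lemma semi_greedy_residual:
  assumes C: "semi_greedy_constant w C"
    and A: "greedy_set es x m A"
    and B: "finite B" "sum w B \<le> sum w A"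
  obtains b where "norm (x - (\<Sum>n\<in>A. b n *\<^sub>R e n)) \<le> C * norm (x - (\<Sum>n\<in>B. a n *\<^sub>R e n))"
proof -
  obtain b where "chebyshev_approximand e x A (\<Sum>n\<in>A. b n *\<^sub>R e n)"
    using chebyshev_approximand_exists greedy_setD(1)[OF A] by blast
  then have "norm (x - (\<Sum>n\<in>A. b n *\<^sub>R e n)) \<le> C * sigma_w e w (sum w A) x"
    using C A unfolding semi_greedy_constant_def by blast
  also have "\<dots> \<le> C * norm (x - (\<Sum>n\<in>B. a n *\<^sub>R e n))"
    using C sigma_w_le[OF B] unfolding semi_greedy_constant_def by (intro mult_left_mono) auto
  finally show thesis by (rule that)
qed

section \<open>Comparison with a block to the right\<close>

text \<open>
  All nonzero coordinates of \<open>1\<^bsub>\<epsilon>A\<^esub> + 1\<^bsub>B\<^esub>\<close> have modulus 1, so \<open>B\<close> is one of its greedy sets.  Since \<open>B\<close>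
  lies to the right of \<open>A\<close>, the projection onto the first \<open>N\<close> coordinates recovers \<open>1\<^bsub>\<epsilon>A\<^esub>\<close> from the
  residual.
\<close>

lemma signed_indicator_le_block:
  assumes C: "semi_greedy_constant w C"
    and K: "\<And>N x. norm (basis_projection {..<N} x) \<le> K * norm x" "K \<ge> 0"
    and A: "A \<subseteq> {..<N}"
    and B: "finite B" "B \<noteq> {}" "B \<subseteq> {N..}" "sum w A \<le> sum w B"
    and sgn: "sign_sequence \<epsilon>"
  shows "norm (signed_indicator e \<epsilon> A) \<le> K * C * norm (\<Sum>n\<in>B. e n)"
proof -
  have finA: "finite A" using A finite_subset by blast
  define y where "y = signed_indicator e \<epsilon> A + (\<Sum>n\<in>B. e n)"
  have coord: "es k y = (if k \<in> A then \<epsilon> k else 0) + (if k \<in> B then 1 else 0)" for k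
    using coordinate_sum[OF finA, of k \<epsilon>] coordinate_sum[OF B(1), of k "\<lambda>_. 1"]
    by (simp add: y_def signed_indicator_def blinfun.add_right)
  have disj: "A \<inter> B = {}" using A B(3) by force
  have "greedy_set es y (card B) B"
  proof (rule greedy_setI[where t = 1])
    fix k
    have "\<bar>\<epsilon> k\<bar> = 1" using sgn unfolding sign_sequence_def by (metis abs_1 abs_minus insertE singletonD)
    then show "k \<notin> B \<Longrightarrow> \<bar>es k y\<bar> \<le> 1" by (simp add: coord)
    show "k \<in> B \<Longrightarrow> 1 \<le> \<bar>es k y\<bar>" using disj by (auto simp: coord)
  qed (use B in auto)
  from semi_greedy_residual[OF C this finA B(4), where a = \<epsilon>]
  obtain b where b: "norm (y - (\<Sum>n\<in>B. b n *\<^sub>R e n)) \<le> C * norm (\<Sum>n\<in>B. e n)"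
    by (auto simp: y_def signed_indicator_def)
  have "basis_projection {..<N} (y - (\<Sum>n\<in>B. b n *\<^sub>R e n))
      = (\<Sum>n<N. (if n \<in> A then \<epsilon> n *\<^sub>R e n else 0))"
    unfolding basis_projection_def using B(3)
    by (intro sum.cong) (auto simp: blinfun.diff_right coordinate_sum[OF B(1)] coord)
  also have "\<dots> = signed_indicator e \<epsilon> A"
    using A by (simp add: signed_indicator_def sum.inter_restrict[symmetric] Int_absorb1)
  finally have "norm (signed_indicator e \<epsilon> A) \<le> K * norm (y - (\<Sum>n\<in>B. b n *\<^sub>R e n))"
    using K(1) by metis
  also have "\<dots> \<le> K * (C * norm (\<Sum>n\<in>B. e n))"
    using b K(2) by (rule mult_left_mono)
  finally show ?thesis by (simp add: mult.assoc)
qed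

text \<open>
  Overwriting the coordinates of \<open>x\<close> on the block, rather than adding \<open>t\<close> to them, keeps them at
  modulus \<open>t\<close>, so that \<open>A\<close> remains a greedy set even when the support of \<open>x\<close> is infinite; it also
  makes the block projection of the residual equal to \<open>t 1\<^bsub>B\<^esub>\<close>.
\<close>

lemma block_le_vector:
  assumes C: "semi_greedy_constant w C"
    and K: "\<And>N x. norm (basis_projection {..<N} x) \<le> K * norm x" "K \<ge> 0"
    and A: "greedy_set es x m A" "A \<subseteq> {..<N}"
    and w: "sum w {N..<M} \<le> sum w A" "N \<le> M"
  shows "Min ((\<lambda>k. \<bar>es k x\<bar>) ` A) * norm (\<Sum>n=N..<M. e n) \<le> 2 * K * C * norm x"
proof -
  define t where "t = Min ((\<lambda>k. \<bar>es k x\<bar>) ` A)"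
  note D = greedy_setD[OF A(1), folded t_def]
  define y where "y = x + (\<Sum>n=N..<M. (t - es n x) *\<^sub>R e n)"
  have coord: "es k y = (if k \<in> {N..<M} then t else es k x)" for k
    using coordinate_sum[of "{N..<M}" k "\<lambda>n. t - es n x"]
    by (auto simp: y_def blinfun.add_right)
  have disj: "A \<inter> {N..<M} = {}" using A(2) by force
  have "greedy_set es y (card A) A"
  proof (rule greedy_setI[where t = t])
    show "t \<le> \<bar>es k y\<bar>" if "k \<in> A" for k
      using D(4)[OF that] that disj by (auto simp: coord)
    show "\<bar>es k y\<bar> \<le> t" if "k \<notin> A" for k
      using D(3) D(5)[OF that] by (auto simp: coord)
  qed (use D in auto)
  from semi_greedy_residual[OF C this finite_atLeastLessThan w(1), where a = "\<lambda>n. t - es n x"]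
  obtain b where b: "norm (y - (\<Sum>n\<in>A. b n *\<^sub>R e n)) \<le> C * norm x"
    by (auto simp: y_def)
  have "basis_projection {N..<M} (y - (\<Sum>n\<in>A. b n *\<^sub>R e n)) = (\<Sum>n=N..<M. t *\<^sub>R e n)"
    unfolding basis_projection_def using disj
    by (intro sum.cong) (auto simp: blinfun.diff_right coordinate_sum[OF D(1)] coord)
  then have "t *\<^sub>R (\<Sum>n=N..<M. e n) = basis_projection {N..<M} (y - (\<Sum>n\<in>A. b n *\<^sub>R e n))"
    by (simp add: scaleR_sum_right)
  then have "t * norm (\<Sum>n=N..<M. e n) = norm (basis_projection {N..<M} (y - (\<Sum>n\<in>A. b n *\<^sub>R e n)))"
    using D(3) by (metis abs_of_pos norm_scaleR)
  also have "\<dots> \<le> 2 * K * norm (y - (\<Sum>n\<in>A. b n *\<^sub>R e n))"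
  proof -
    let ?z = "y - (\<Sum>n\<in>A. b n *\<^sub>R e n)"
    show ?thesis
      using norm_triangle_ineq4[of "basis_projection {..<M} ?z" "basis_projection {..<N} ?z"]
        K(1)[of M ?z] K(1)[of N ?z]
      unfolding block_projection[OF w(2)] by linarith
  qed
  also have "\<dots> \<le> 2 * K * (C * norm x)"
    using b K(2) by (intro mult_left_mono) auto
  finally show ?thesis by (simp add: t_def mult.assoc)
qed

end

text \<open>
  Since the weights are bounded away from 0, the weights of the blocks starting at \<open>N\<close> grow beyond
  every bound, so there is a first index at which \<open>s\<close> is exceeded.  The block before it may
  be empty.
\<close>

lemma maximal_block:
  fixes w :: "nat \<Rightarrow> real"
  assumes "c > 0" "\<And>n. c \<le> w n" "s \<ge> 0"
  shows "\<exists>M\<ge>N. sum w {N..<M} \<le> s \<and> s < sum w {N..<Suc M}"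
proof -
  obtain j where j: "s < real j * c"
    using reals_Archimedean3[OF assms(1)] by blast
  have "real j * c \<le> sum w {N..<N + j}"
    using sum_bounded_below[of "{N..<N + j}" c w] assms(2) by simp
  with j have "s < sum w {N..<N + j}" by linarith
  then obtain i where i: "s < sum w {N..<N + i}" "\<And>k. k < i \<Longrightarrow> \<not> s < sum w {N..<N + k}"
    using exists_least_iff[of "\<lambda>j. s < sum w {N..<N + j}"] by blast
  from i(1) assms(3) obtain k where k: "i = Suc k" by (cases i) auto
  show ?thesis
    using i(1) i(2)[of k] k by (intro exI[of _ "N + k"]) auto
qed

section \<open>Property (C)\<close>

theorem proposition4p10:
  fixes e :: "nat \<Rightarrow> 'a::banach"
    and es :: "nat \<Rightarrow> 'a \<Rightarrow>\<^sub>L real"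
    and w :: "nat \<Rightarrow> real"
  assumes "basis_system e es"
    and "weight w"
    and "0 < (INF n. w n)" and "bdd_above (range w)"
    and "w_semi_greedy e es w"
  shows "property_C e es"
proof -
  interpret seminormalized_basis e es by unfold_locales fact
  obtain C where semi_greedy: "semi_greedy_constant w C"
    using assms(5) unfolding w_semi_greedy_def semi_greedy_constant_def by blast
  then have C: "C \<ge> 1" by (simp add: semi_greedy_constant_def)
  obtain K where K: "K > 0" "\<And>N x. norm (basis_projection {..<N} x) \<le> K * norm x"
    using initial_projection_bound by metis
  have K0: "K \<ge> 0" using K by simp
  obtain R where R: "R > 0" "\<And>n. norm (e n) \<le> R" "\<And>n. norm (es n) \<le> R"
    using common_bound by metis
  have w_pos: "0 < w n" for n using assms(2) by (simp add: weight_def)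
  have w_lower: "(INF n. w n) \<le> w n" for n
    using w_pos by (intro cINF_lower bdd_belowI[of _ 0]) (auto intro: less_imp_le)
  \<comment> \<open>\<open>2 * K * C\<close> comes from the maximal block, \<open>R * R\<close> from the adjoined basis vector, and the
    factor \<open>K * C\<close> from passing from the extended block to the signed indicator.\<close>
  define D where "D = K * C * (2 * K * C + R * R)"
  have "D > 0" unfolding D_def using K C R by (intro mult_pos_pos add_nonneg_pos) auto
  moreover have "Min ((\<lambda>j. \<bar>es j x\<bar>) ` \<Lambda>) * norm (signed_indicator e \<epsilon> \<Lambda>) \<le> D * norm x"
    if greedy: "greedy_set es x m \<Lambda>" and sgn: "sign_sequence \<epsilon>" for x m \<Lambda> \<epsilon>
  proof -
    define t where "t = Min ((\<lambda>j. \<bar>es j x\<bar>) ` \<Lambda>)"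
    note G = greedy_setD[OF greedy, folded t_def]
    obtain N where N: "\<Lambda> \<subseteq> {..<N}"
      using G(1) finite_nat_bounded by blast
    have weight_nonneg: "sum w \<Lambda> \<ge> 0" using w_pos by (intro sum_nonneg) (auto intro: less_imp_le)
    obtain M where M: "N \<le> M" "sum w {N..<M} \<le> sum w \<Lambda>" "sum w \<Lambda> < sum w {N..<Suc M}"
      using maximal_block[where w = w and N = N, OF assms(3) w_lower weight_nonneg] by blast
    have block: "t * norm (\<Sum>n=N..<M. e n) \<le> 2 * K * C * norm x"
      unfolding t_def
      by (rule block_le_vector[OF semi_greedy K(2) K0 greedy N M(2) M(1)])
    obtain j where j: "j \<in> \<Lambda>" using G(2) by blast
    have "t \<le> R * norm x"
      using G(4)[OF j] bounded_coordinates[OF R(3), of j x] by linarith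
    then have last: "t * norm (e M) \<le> R * norm x * R"
      using R G(3) by (intro mult_mono) auto
    have "norm (\<Sum>n=N..<Suc M. e n) \<le> norm (\<Sum>n=N..<M. e n) + norm (e M)"
      using M(1) norm_triangle_ineq by simp
    then have "t * norm (\<Sum>n=N..<Suc M. e n) \<le> t * (norm (\<Sum>n=N..<M. e n) + norm (e M))"
      using G(3) by (intro mult_left_mono) auto
    also have "\<dots> \<le> (2 * K * C + R * R) * norm x"
      using block last by (simp add: algebra_simps)
    finally have extended: "t * norm (\<Sum>n=N..<Suc M. e n) \<le> (2 * K * C + R * R) * norm x" .
    have "norm (signed_indicator e \<epsilon> \<Lambda>) \<le> K * C * norm (\<Sum>n=N..<Suc M. e n)"
      using M by (intro signed_indicator_le_block[OF semi_greedy K(2) K0 N _ _ _ _ sgn]) auto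
    then have "t * norm (signed_indicator e \<epsilon> \<Lambda>) \<le> t * (K * C * norm (\<Sum>n=N..<Suc M. e n))"
      using G(3) by (intro mult_left_mono) auto
    also have "\<dots> = K * C * (t * norm (\<Sum>n=N..<Suc M. e n))"
      by simp
    also have "\<dots> \<le> K * C * ((2 * K * C + R * R) * norm x)"
      using extended K0 C by (intro mult_left_mono) auto
    finally show ?thesis by (simp add: D_def t_def mult.assoc)
  qed
  ultimately show ?thesis unfolding property_C_def by blast
qed

end
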